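(* Let $A_3$ be an antichain (poset) with $|A_3|=3$. Then for every integer $k\ge 1$, we have $s_3(k)=|J^{k-1}(A_3)|$. Moreover, for every integer $k\ge 5$, \[ (\operatorname{twr}_{k-2}(2))^2 \le s_3(k)=|J^{k-1}(A_3)|\le \frac{\operatorname{twr}_{k-1}(2)}{2}. \]
   Context: Write $[n]=\{1,\dots,n\}$ and let $\binom{[N]}{k}$ denote the set of $k$-element subsets of $[N]$. For integers $N,k\ge 1$, the shift graph $\operatorname{Sh}(N,k)$ is the directed graph with vertex set $\binom{[N]}{k}$ in which, for all $x_1<x_2<\cdots<x_{k+1}$ in $[N]$, there is an arc $\{x_1,\ldots,x_k\}\to\{x_2,\ldots,x_{k+1}\}$ (and no other arcs). Its chromatic number $\chi(\operatorname{Sh}(N,k))$ is that of the underlying undirected graph. The $3$-color shift number is $s_3(k)=\max\{N:\chi(\operatorname{Sh}(N,k))\le 3\}$ (this maximum exists, since for fixed $k$ Ramsey's theorem gives $\chi(\operatorname{Sh}(N,k))\to\infty$ as $N\to\infty$). For a poset $Q$, a down-set is a subset $S\subseteq Q$ such that $y\in S$ and $x\le y$ imply $x\in S$ (the empty set is a down-set). $J(Q)$ is the poset of all down-sets of $Q$ ordered by inclusion; $J^0(Q)=Q$ and $J^i(Q)=J(J^{i-1}(Q))$ for $i\ge 1$. $|Q|$ is the number of elements of $Q$. An antichain is a set of pairwise incomparable elements; $A_3$ is viewed as the poset consisting of three pairwise incomparable elements. The tower function is defined by $\operatorname{twr}_1(x)=x$ and $\operatorname{twr}_{i+1}(x)=2^{\operatorname{twr}_i(x)}$.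 *)

theory Defs
  imports Complex_Main "HOL-Library.FSet" "HOL-Library.Ramsey" "Graph_Theory.Digraph_Component"
begin

section \<open>Shift graphs and their chromatic number\<close>

text \<open>\<open>[{1..N}]\<^bsup>k\<^esup>\<close> is the set of \<open>k\<close>-element subsets of \<open>{1, ..., N}\<close>.\<close>

definition shift_graph :: "nat \<Rightarrow> nat \<Rightarrow> nat set pair_pre_digraph" where
  "shift_graph N k =
    \<lparr> pverts = [{1..N}]\<^bsup>k\<^esup>,
      parcs = {(x ` {1..k}, x ` {2..k + 1}) | x.
                 strict_mono_on {1..k + 1} x \<and> x ` {1..k + 1} \<subseteq> {1..N}} \<rparr>"

definition proper_colouring :: "'a pair_pre_digraph \<Rightarrow> nat \<Rightarrow> ('a \<Rightarrow> nat) \<Rightarrow> bool" where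
  "proper_colouring G c f \<longleftrightarrow>
    f ` pverts G \<subseteq> {..<c} \<and> (\<forall>(u, v) \<in> parcs G. f u \<noteq> f v)"

text \<open>
  The chromatic number of a digraph is that of the underlying undirected graph,
  represented as its symmetric closure.
\<close>

definition chromatic_number :: "'a pair_pre_digraph \<Rightarrow> nat" where
  "chromatic_number G =
    (LEAST c. \<exists>f. proper_colouring (mk_symmetric (with_proj G)) c f)"

definition s3 :: "nat \<Rightarrow> nat" where
  "s3 k = Max {N. N \<ge> 1 \<and> chromatic_number (shift_graph N k) \<le> 3}"

section \<open>Iterated posets of down-sets\<close>

text \<open>A poset is a carrier together with its reflexive order relation on that carrier.\<close>

type_synonym 'a poset = "'a set \<times> 'a rel"

definition is_poset :: "'a poset \<Rightarrow> bool" where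
  "is_poset Q \<longleftrightarrow> partial_order_on (fst Q) (snd Q)"

definition is_antichain :: "'a poset \<Rightarrow> bool" where
  "is_antichain Q \<longleftrightarrow>
    (\<forall>x \<in> fst Q. \<forall>y \<in> fst Q. x \<noteq> y \<longrightarrow> (x, y) \<notin> snd Q \<and> (y, x) \<notin> snd Q)"

definition down_sets :: "'a poset \<Rightarrow> 'a set set" where
  "down_sets Q = {S. S \<subseteq> fst Q \<and> (\<forall>x \<in> fst Q. \<forall>y \<in> S. (x, y) \<in> snd Q \<longrightarrow> x \<in> S)}"

definition J :: "'a poset \<Rightarrow> 'a set poset" where
  "J Q = (down_sets Q, {(S, T). S \<in> down_sets Q \<and> T \<in> down_sets Q \<and> S \<subseteq> T})"

text \<open>
  Since \<open>J\<close> changes the element type, it cannot be iterated a variable number of times as it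
  stands. The elements of all iterates of a poset over \<open>'a\<close> are therefore collected in one type:
  \<open>Base a\<close> is an element of the original poset and \<open>Down S\<close> is a down-set of the previous iterate.
  The type contains finite down-sets only, so this is the poset of all down-sets precisely when
  every down-set is finite, in particular for every finite poset (see \<open>J_iso\<close> below).
\<close>

datatype 'a iter = Base 'a | Down "'a iter fset"

definition J_step :: "'a iter poset \<Rightarrow> 'a iter poset" where
  "J_step Q =
    ({Down S | S. fset S \<in> fst (J Q)}, {(Down S, Down T) | S T. (fset S, fset T) \<in> snd (J Q)})"

primrec J_iter :: "nat \<Rightarrow> 'a poset \<Rightarrow> 'a iter poset" where
  "J_iter 0 Q = (Base ` fst Q, map_prod Base Base ` snd Q)"
| "J_iter (Suc i) Q = J_step (J_iter i Q)"

definition poset_iso :: "('a \<Rightarrow> 'b) \<Rightarrow> 'a poset \<Rightarrow> 'b poset \<Rightarrow> bool" where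
  "poset_iso h P Q \<longleftrightarrow> bij_betw h (fst P) (fst Q) \<and>
    (\<forall>x \<in> fst P. \<forall>y \<in> fst P. (x, y) \<in> snd P \<longleftrightarrow> (h x, h y) \<in> snd Q)"

lemma J_step_iso:
  assumes "finite (fst Q)"
  shows "poset_iso (Down \<circ> Abs_fset) (J Q) (J_step Q)"
proof -
  have fin: "finite S" if "S \<in> down_sets Q" for S
    using that assms by (auto simp: down_sets_def intro: finite_subset)
  have inv: "fset (Abs_fset S) = S" if "S \<in> down_sets Q" for S
    using fin[OF that] by (simp add: Abs_fset_inverse)
  have "inj_on (Down \<circ> Abs_fset) (down_sets Q)"
    by (rule inj_onI) (metis comp_apply inv iter.inject(2))
  moreover have "(Down \<circ> Abs_fset) ` down_sets Q = {Down S | S. fset S \<in> down_sets Q}"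
    by (force simp: image_iff inv fset_inverse)
  ultimately show ?thesis
    by (auto simp: poset_iso_def bij_betw_def J_def J_step_def inv)
qed

lemma finite_J_iter:
  assumes "finite (fst Q)"
  shows "finite (fst (J_iter i Q))"
proof (induction i)
  case 0
  show ?case using assms by simp
next
  case (Suc i)
  have "finite (down_sets (J_iter i Q))"
    by (rule finite_subset[of _ "Pow (fst (J_iter i Q))"]) (auto simp: down_sets_def Suc)
  then have "finite (fst (J (J_iter i Q)))" by (simp add: J_def)
  then show ?case
    using J_step_iso[OF Suc] by (auto simp: poset_iso_def dest: bij_betw_finite)
qed

lemma J_iter_0_iso: "poset_iso Base Q (J_iter 0 Q)"
  by (auto simp: poset_iso_def bij_betw_def inj_on_def)

lemma J_iso:
  assumes "finite (fst Q)"
  shows "poset_iso (Down \<circ> Abs_fset) (J (J_iter i Q)) (J_iter (Suc i) Q)"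
  using J_step_iso[OF finite_J_iter[OF assms]] by simp

section \<open>The tower function\<close>

text \<open>Indexed from 1; \<open>twr 0\<close> is left unspecified.\<close>

fun twr :: "nat \<Rightarrow> nat \<Rightarrow> nat" where
  "twr (Suc 0) x = x"
| "twr (Suc (Suc i)) x = 2 ^ twr (Suc i) x"

end

theory Submission
  imports Defs
begin

text \<open>
  Colour a shift graph by a poset \<open>Q\<close> such that along an arc \<open>U \<rightarrow> V\<close> the colour of \<open>V\<close> is never
  below that of \<open>U\<close>; for the antichain \<open>A\<^sub>3\<close> these are the proper 3-colourings. The vertices of
  \<open>Sh(N, k + 1)\<close> are the arcs of \<open>Sh(N, k)\<close>, and colourings of the arcs by \<open>Q\<close> correspond to
  colourings of the vertices by \<open>J(Q)\<close>. Hence 3-colourings of \<open>Sh(N, k)\<close> correspond to colourings of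
  \<open>Sh(N, 1)\<close> by \<open>J\<^bsup>k-1\<^esup>(A\<^sub>3)\<close>, that is, to initial pieces of linear extensions of that poset.

  For the lower bound, an antichain of size \<open>w\<close> in \<open>Q\<close> gives \<open>2\<^sup>w\<close> down-sets, and those generated by
  its subsets of a fixed size form an antichain in \<open>J(Q)\<close>; the growth starts from an antichain of
  size 7 in \<open>J\<^sup>3(A\<^sub>3)\<close>. For the upper bound, \<open>|J(Q)| \<le> 2\<^bsup>|Q|\<^esup>\<close> suffices once \<open>|J\<^sup>4(A\<^sub>3)| \<le> 2\<^sup>1\<^sup>5\<close> is known.
  This is verified by computation: the number of down-sets containing and avoiding an element are
  counted separately, and after nine such steps the number of down-sets of a subposet covered by
  chains \<open>C\<close> is bounded by the product of the \<open>|C| + 1\<close>.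
\<close>

section \<open>Colourings of shift graphs with values in a poset\<close>

text \<open>A homomorphism from the shift graph to the digraph on \<open>Q\<close> with an arc \<open>x \<rightarrow> y\<close> iff not \<open>y \<le> x\<close>.\<close>

definition shift_colouring :: "nat \<Rightarrow> nat \<Rightarrow> 'a poset \<Rightarrow> (nat set \<Rightarrow> 'a) \<Rightarrow> bool" where
  "shift_colouring N k Q f \<longleftrightarrow> f ` ([{1..N}]\<^bsup>k\<^esup>) \<subseteq> fst Q \<and>
     (\<forall>W \<in> [{1..N}]\<^bsup>Suc k\<^esup>. (f (W - {Min W}), f (W - {Max W})) \<notin> snd Q)"

lemma nsets_Suc_props:
  assumes "W \<in> [A]\<^bsup>Suc k\<^esup>"
  shows "finite W" "W \<noteq> {}" "card W = Suc k" "W \<subseteq> A"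
  using assms by (auto simp: nsets_def)

lemma nsets_minus_single: "W \<in> [A]\<^bsup>Suc k\<^esup> \<Longrightarrow> a \<in> W \<Longrightarrow> W - {a} \<in> [A]\<^bsup>k\<^esup>"
  by (auto simp: nsets_def)

lemma nsets_minus_Min: "W \<in> [A]\<^bsup>Suc k\<^esup> \<Longrightarrow> W - {Min W} \<in> [A :: 'a :: linorder set]\<^bsup>k\<^esup>"
  using nsets_minus_single[OF _ Min_in[OF nsets_Suc_props(1,2)]] .

lemma nsets_minus_Max: "W \<in> [A]\<^bsup>Suc k\<^esup> \<Longrightarrow> W - {Max W} \<in> [A :: 'a :: linorder set]\<^bsup>k\<^esup>"
  using nsets_minus_single[OF _ Max_in[OF nsets_Suc_props(1,2)]] .

lemma strict_mono_on_image_ends: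
  fixes x :: "nat \<Rightarrow> nat"
  assumes x: "strict_mono_on {1..k + 1} x"
  defines "W \<equiv> x ` {1..k + 1}"
  shows "card W = k + 1" "W - {Max W} = x ` {1..k}" "W - {Min W} = x ` {2..k + 1}"
proof -
  have inj: "inj_on x {1..k + 1}"
    using x by (rule strict_mono_on_imp_inj_on)
  then show "card W = k + 1"
    by (simp add: W_def card_image)
  have le: "x i \<le> x j" if "i \<in> {1..k + 1}" "j \<in> {1..k + 1}" "i \<le> j" for i j
    using x that by (metis le_less strict_mono_onD)
  have Max: "Max W = x (k + 1)"
    unfolding W_def by (rule Max_eqI) (auto intro: le)
  have Min: "Min W = x 1"
    unfolding W_def by (rule Min_eqI) (auto intro: le)
  have "W - {Max W} = x ` ({1..k + 1} - {k + 1})"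
    unfolding Max unfolding W_def using inj_on_image_set_diff[OF inj, of "{1..k+1}" "{k+1}"] by auto
  also have "{1..k + 1} - {k + 1} = {1..k}"
    by auto
  finally show "W - {Max W} = x ` {1..k}" .
  have "W - {Min W} = x ` ({1..k + 1} - {1})"
    unfolding Min unfolding W_def using inj_on_image_set_diff[OF inj, of "{1..k+1}" "{1}"] by auto
  also have "{1..k + 1} - {1} = {2..k + 1}"
    by auto
  finally show "W - {Min W} = x ` {2..k + 1}" .
qed

lemma ex_strict_mono_on_enumeration:
  fixes W :: "nat set"
  assumes "finite W"
  obtains x where "strict_mono_on {1..card W} x" "x ` {1..card W} = W"
proof
  define x where "x = (\<lambda>i. sorted_list_of_set W ! (i - 1))"
  show "strict_mono_on {1..card W} x"
    using sorted_wrt_nth_less[OF strict_sorted_list_of_set[of W]]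
    by (intro strict_mono_onI) (auto simp: x_def)
  have "x ` {1..card W} = (!) (sorted_list_of_set W) ` ((\<lambda>i. i - 1) ` {1..card W})"
    by (auto simp: x_def)
  also have "(\<lambda>i. i - 1) ` {1..card W} = {0..<card W}"
    by (force simp: image_iff)
  also have "(!) (sorted_list_of_set W) ` {0..<card W} = W"
    using assms by (metis atLeast0LessThan length_sorted_list_of_set list.set_map map_nth set_sorted_list_of_set set_upt atLeast_upt)
  finally show "x ` {1..card W} = W" .
qed

text \<open>An increasing enumeration matters only through its image \<open>W\<close>. Replacing
  enumerations by sets lets an arc be treated as a vertex of the next shift graph.\<close>

lemma parcs_shift_graph:
  "parcs (shift_graph N k) = (\<lambda>W. (W - {Max W}, W - {Min W})) ` ([{1..N}]\<^bsup>Suc k\<^esup>)"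
proof (intro equalityI subsetI)
  fix e assume "e \<in> parcs (shift_graph N k)"
  then obtain x where x: "strict_mono_on {1..k + 1} x" "x ` {1..k + 1} \<subseteq> {1..N}"
    and e: "e = (x ` {1..k}, x ` {2..k + 1})"
    by (auto simp: shift_graph_def)
  have "x ` {1..k + 1} \<in> [{1..N}]\<^bsup>Suc k\<^esup>"
    using x strict_mono_on_image_ends(1)[OF x(1)] by (simp add: nsets_def)
  then show "e \<in> (\<lambda>W. (W - {Max W}, W - {Min W})) ` ([{1..N}]\<^bsup>Suc k\<^esup>)"
    unfolding e using strict_mono_on_image_ends(2,3)[OF x(1)] by (metis (mono_tags, lifting) image_eqI)
next
  fix e assume "e \<in> (\<lambda>W. (W - {Max W}, W - {Min W})) ` ([{1..N}]\<^bsup>Suc k\<^esup>)"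
  then obtain W where W: "W \<in> [{1..N}]\<^bsup>Suc k\<^esup>" and e: "e = (W - {Max W}, W - {Min W})"
    by auto
  have card: "card W = k + 1" and "finite W" "W \<subseteq> {1..N}"
    using nsets_Suc_props[OF W] by auto
  then obtain x where x: "strict_mono_on {1..k + 1} x" "x ` {1..k + 1} = W"
    using ex_strict_mono_on_enumeration[of W] by metis
  then have "e = (x ` {1..k}, x ` {2..k + 1})"
    using strict_mono_on_image_ends(2,3)[OF x(1)] e by simp
  then show "e \<in> parcs (shift_graph N k)"
    using x \<open>W \<subseteq> {1..N}\<close> by (auto simp: shift_graph_def)
qed

lemma pverts_shift_graph: "pverts (shift_graph N k) = [{1..N}]\<^bsup>k\<^esup>"
  by (simp add: shift_graph_def)

lemma proper_colouring_mk_symmetric: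
  "proper_colouring (mk_symmetric (with_proj G)) c f \<longleftrightarrow> proper_colouring G c f"
  by (fastforce simp: proper_colouring_def mk_symmetric_def)

lemma Min_Max_remove_ends:
  fixes W :: "nat set"
  assumes "finite W" "card W \<ge> 2"
  shows "Min W < Min (W - {Min W})" "Min (W - {Max W}) = Min W" "Max (W - {Min W}) = Max W"
    "Min W < Max W"
proof -
  have ne: "W \<noteq> {}"
    using assms by auto
  have *: "W - {a} \<noteq> {}" for a
  proof
    assume "W - {a} = {}"
    then have "card W \<le> card {a}"
      by (intro card_mono) auto
    then show False
      using assms by simp
  qed
  have "Min (W - {Min W}) \<in> W - {Min W}"
    using assms * by (intro Min_in) auto
  then show **: "Min W < Min (W - {Min W})"
    using assms by (metis Diff_iff Min_le insertI1 le_neq_implies_less)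
  also have "Min (W - {Min W}) \<le> Max W"
    using \<open>Min (W - {Min W}) \<in> W - {Min W}\<close> assms by simp
  finally show "Min W < Max W" .
  then show "Min (W - {Max W}) = Min W" "Max (W - {Min W}) = Max W"
    using assms Min_in[OF assms(1) ne] Max_in[OF assms(1) ne] by (auto intro!: Min_eqI Max_eqI)
qed

text \<open>
  The minimum of a vertex is a proper colouring, so the set defining \<open>chromatic_number\<close> is not empty.
\<close>

lemma chromatic_number_shift_graph_le_iff:
  assumes "k \<ge> 1"
  shows "chromatic_number (shift_graph N k) \<le> c \<longleftrightarrow> (\<exists>f. proper_colouring (shift_graph N k) c f)"
proof -
  have "proper_colouring (shift_graph N k) (Suc N) Min"
    unfolding proper_colouring_def pverts_shift_graph parcs_shift_graph
  proof (intro conjI ballI)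
    show "Min ` ([{1..N}]\<^bsup>k\<^esup>) \<subseteq> {..<Suc N}"
    proof (intro image_subsetI)
      fix V assume "V \<in> [{1..N}]\<^bsup>k\<^esup>"
      then have "Min V \<in> V" "V \<subseteq> {1..N}"
        using assms by (auto simp: nsets_def intro!: Min_in)
      then show "Min V \<in> {..<Suc N}"
        by auto
    qed
  next
    fix e assume "e \<in> (\<lambda>W. (W - {Max W}, W - {Min W})) ` ([{1..N}]\<^bsup>Suc k\<^esup>)"
    then obtain W where W: "W \<in> [{1..N}]\<^bsup>Suc k\<^esup>" and e: "e = (W - {Max W}, W - {Min W})"
      by auto
    show "case e of (u, v) \<Rightarrow> Min u \<noteq> Min v"
      using Min_Max_remove_ends[of W] nsets_Suc_props[OF W] assms by (simp add: e)
  qed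
  then have "\<exists>c f. proper_colouring (shift_graph N k) c f"
    by blast
  from LeastI_ex[OF this]
  have ex: "\<exists>f. proper_colouring (shift_graph N k) (chromatic_number (shift_graph N k)) f"
    unfolding chromatic_number_def proper_colouring_mk_symmetric .
  show ?thesis
  proof
    assume "chromatic_number (shift_graph N k) \<le> c"
    then show "\<exists>f. proper_colouring (shift_graph N k) c f"
      using ex unfolding proper_colouring_def by (meson lessThan_subset_iff subset_trans)
  next
    assume "\<exists>f. proper_colouring (shift_graph N k) c f"
    then show "chromatic_number (shift_graph N k) \<le> c"
      unfolding chromatic_number_def proper_colouring_mk_symmetric by (rule Least_le)
  qed
qed

section \<open>Proper colourings as colourings by an antichain\<close>

lemma is_posetD:
  assumes "is_poset Q"
  shows "x \<in> fst Q \<Longrightarrow> (x, x) \<in> snd Q"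
    "(x, y) \<in> snd Q \<Longrightarrow> (y, z) \<in> snd Q \<Longrightarrow> (x, z) \<in> snd Q"
    "(x, y) \<in> snd Q \<Longrightarrow> (y, x) \<in> snd Q \<Longrightarrow> x = y"
proof -
  have "refl_on (fst Q) (snd Q)" "trans (snd Q)" "antisym (snd Q)"
    using assms by (auto simp: is_poset_def partial_order_on_def preorder_on_def)
  then show "x \<in> fst Q \<Longrightarrow> (x, x) \<in> snd Q"
    "(x, y) \<in> snd Q \<Longrightarrow> (y, z) \<in> snd Q \<Longrightarrow> (x, z) \<in> snd Q"
    "(x, y) \<in> snd Q \<Longrightarrow> (y, x) \<in> snd Q \<Longrightarrow> x = y"
    by (blast dest: refl_onD transD antisymD)+
qed

lemma antichain_poset_le_iff:
  assumes "is_poset Q" "is_antichain Q" "x \<in> fst Q" "y \<in> fst Q"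
  shows "(x, y) \<in> snd Q \<longleftrightarrow> x = y"
  using assms is_posetD(1) by (fastforce simp: is_antichain_def)

text \<open>In an antichain the order is equality, so an arc only has to change the colour; a
  bijection between \<open>fst Q\<close> and \<open>{..<c}\<close> translates the colours.\<close>

lemma proper_colouring_iff_shift_colouring:
  assumes Q: "is_poset Q" "is_antichain Q" and card: "card (fst Q) = c" "c > 0"
  shows "(\<exists>f. proper_colouring (shift_graph N k) c f) \<longleftrightarrow> (\<exists>f. shift_colouring N k Q f)"
proof -
  have "finite (fst Q)"
    using card card_gt_0_iff by metis
  then obtain g where g: "bij_betw g (fst Q) {..<c}"
    using ex_bij_betw_finite_nat card by (metis atLeast0LessThan)
  define h where "h = inv_into (fst Q) g"
  have h: "bij_betw h {..<c} (fst Q)"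
    unfolding h_def using g by (rule bij_betw_inv_into)
  show ?thesis
  proof
    assume "\<exists>f. proper_colouring (shift_graph N k) c f"
    then obtain f where f: "f ` ([{1..N}]\<^bsup>k\<^esup>) \<subseteq> {..<c}"
      "\<forall>W \<in> [{1..N}]\<^bsup>Suc k\<^esup>. f (W - {Max W}) \<noteq> f (W - {Min W})"
      by (auto simp: proper_colouring_def pverts_shift_graph parcs_shift_graph)
    have "shift_colouring N k Q (h \<circ> f)"
      unfolding shift_colouring_def
    proof (intro conjI ballI)
      show "(h \<circ> f) ` ([{1..N}]\<^bsup>k\<^esup>) \<subseteq> fst Q"
        using f(1) h by (auto simp: bij_betw_def)
    next
      fix W assume W: "W \<in> [{1..N}]\<^bsup>Suc k\<^esup>"
      then have "f (W - {Min W}) \<in> {..<c}" "f (W - {Max W}) \<in> {..<c}"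
        using f(1) nsets_minus_Min[OF W] nsets_minus_Max[OF W] by blast+
      then show "((h \<circ> f) (W - {Min W}), (h \<circ> f) (W - {Max W})) \<notin> snd Q"
        using f(2) W h antichain_poset_le_iff[OF Q]
        by (metis (no_types, lifting) bij_betwE bij_betw_imp_inj_on comp_apply inj_onD)
    qed
    then show "\<exists>f. shift_colouring N k Q f" by blast
  next
    assume "\<exists>f. shift_colouring N k Q f"
    then obtain f where f: "f ` ([{1..N}]\<^bsup>k\<^esup>) \<subseteq> fst Q"
      "\<forall>W \<in> [{1..N}]\<^bsup>Suc k\<^esup>. (f (W - {Min W}), f (W - {Max W})) \<notin> snd Q"
      by (auto simp: shift_colouring_def)
    have "(g \<circ> f) ` ([{1..N}]\<^bsup>k\<^esup>) \<subseteq> {..<c}"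
      using f(1) g by (auto simp: bij_betw_def)
    moreover have "(g \<circ> f) (W - {Max W}) \<noteq> (g \<circ> f) (W - {Min W})"
      if W: "W \<in> [{1..N}]\<^bsup>Suc k\<^esup>" for W
    proof -
      have "f (W - {Min W}) \<in> fst Q" "f (W - {Max W}) \<in> fst Q"
        using f(1) nsets_minus_Min[OF W] nsets_minus_Max[OF W] by blast+
      then show ?thesis
        using f(2) W g antichain_poset_le_iff[OF Q]
        by (metis (no_types, lifting) bij_betw_imp_inj_on comp_apply inj_onD)
    qed
    ultimately have "proper_colouring (shift_graph N k) c (g \<circ> f)"
      by (auto simp: proper_colouring_def pverts_shift_graph parcs_shift_graph)
    then show "\<exists>f. proper_colouring (shift_graph N k) c f" by blast
  qed
qed

text \<open>\<open>W'\<close> and \<open>W\<close> are consecutive arcs: the head of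
  \<open>W'\<close> is the tail of \<open>W\<close>. As \<open>k\<close> is positive, this common
  vertex is nonempty, which places \<open>Min W'\<close> below all of \<open>W\<close>; hence
  \<open>X\<close> is the arc from \<open>W'\<close> to \<open>W\<close> in the next shift
  graph.\<close>

lemma nsets_glue:
  fixes W W' :: "nat set"
  assumes W: "W \<in> [A]\<^bsup>Suc k\<^esup>" and W': "W' \<in> [A]\<^bsup>Suc k\<^esup>" and "k \<ge> 1"
    and eq: "W' - {Min W'} = W - {Max W}"
  defines "X \<equiv> insert (Min W') W"
  shows "X \<in> [A]\<^bsup>Suc (Suc k)\<^esup>" "X - {Min X} = W" "X - {Max X} = W'"
proof -
  note props = nsets_Suc_props[OF W] nsets_Suc_props[OF W']
  have lt: "Min W' < Max W"
  proof -
    have "W - {Max W} \<in> [A]\<^bsup>k\<^esup>"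
      using nsets_minus_Max[OF W] .
    then have "W - {Max W} \<noteq> {}"
      using \<open>k \<ge> 1\<close> unfolding nsets_def by (metis (lifting) card.empty mem_Collect_eq not_one_le_zero)
    then obtain v where v: "v \<in> W - {Max W}"
      by blast
    then have "v < Max W"
      using props by (metis Diff_iff Max_ge insertI1 le_neq_implies_less)
    moreover have "Min W' < v"
      using v props unfolding eq[symmetric] by (metis Diff_iff Min_le insertI1 le_neq_implies_less)
    ultimately show ?thesis
      by simp
  qed
  have less: "Min W' < w" if "w \<in> W" for w
  proof (cases "w = Max W")
    case False
    then have "w \<in> W' - {Min W'}"
      using that eq by auto
    then show ?thesis
      using props by (metis Diff_iff Min_le insertI1 le_neq_implies_less)
  qed (use lt in simp)
  then have notin: "Min W' \<notin> W"
    by blast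
  have "Min W' \<in> A"
    using Min_in[OF props(5,6)] props(8) by (rule rev_subsetD)
  then show "X \<in> [A]\<^bsup>Suc (Suc k)\<^esup>"
    using props notin by (auto simp: X_def nsets_def)
  have "Min X = Min W'"
    unfolding X_def using props less by (intro Min_eqI) (auto intro: less_imp_le)
  then show "X - {Min X} = W"
    using notin by (auto simp: X_def)
  have "Max X = Max W"
    unfolding X_def using props lt by (simp add: Max_insert)
  then have "X - {Max X} = insert (Min W') (W - {Max W})"
    using lt by (auto simp: X_def)
  also have "\<dots> = W'"
    unfolding eq[symmetric] using props by (simp add: insert_absorb)
  finally show "X - {Max X} = W'" .
qed

text \<open>
  A set of \<open>k + 1\<close> elements is an arc of the shift graph on the \<open>k\<close>-sets. From \<open>f\<close> one gets \<open>F\<close> by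
  collecting at each vertex what lies below a colour of an incoming arc; from \<open>F\<close> one gets \<open>f\<close>
  by choosing on each arc an element of the down-set at its head that is missing at its tail.
\<close>

lemma shift_colouring_Suc_iff_J:
  assumes Q: "is_poset Q" and k: "k \<ge> 1"
  shows "(\<exists>f. shift_colouring N (Suc k) Q f) \<longleftrightarrow> (\<exists>F. shift_colouring N k (J Q) F)"
proof
  assume "\<exists>f. shift_colouring N (Suc k) Q f"
  then obtain f where f: "f ` ([{1..N}]\<^bsup>Suc k\<^esup>) \<subseteq> fst Q"
    "\<And>X. X \<in> [{1..N}]\<^bsup>Suc (Suc k)\<^esup> \<Longrightarrow> (f (X - {Min X}), f (X - {Max X})) \<notin> snd Q"
    by (auto simp: shift_colouring_def)
  define F where
    "F V = {q \<in> fst Q. \<exists>W \<in> [{1..N}]\<^bsup>Suc k\<^esup>. W - {Min W} = V \<and> (q, f W) \<in> snd Q}" for V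
  have down: "F V \<in> down_sets Q" for V
    unfolding F_def down_sets_def using is_posetD(2)[OF Q] by blast
  have "\<not> F (W - {Min W}) \<subseteq> F (W - {Max W})" if W: "W \<in> [{1..N}]\<^bsup>Suc k\<^esup>" for W
  proof
    assume "F (W - {Min W}) \<subseteq> F (W - {Max W})"
    moreover have "f W \<in> F (W - {Min W})"
      unfolding F_def using W f(1) is_posetD(1)[OF Q] by blast
    ultimately have "f W \<in> F (W - {Max W})"
      by (rule subsetD)
    then obtain W' where W': "W' \<in> [{1..N}]\<^bsup>Suc k\<^esup>" "W' - {Min W'} = W - {Max W}"
      "(f W, f W') \<in> snd Q"
      unfolding F_def by auto
    show False
      using f(2)[OF nsets_glue(1)[OF W W'(1) k W'(2)]] W'(3)
      unfolding nsets_glue(2,3)[OF W W'(1) k W'(2)] by contradiction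
  qed
  then have "shift_colouring N k (J Q) F"
    using down by (auto simp: shift_colouring_def J_def)
  then show "\<exists>F. shift_colouring N k (J Q) F" by blast
next
  assume "\<exists>F. shift_colouring N k (J Q) F"
  then obtain F where F: "F ` ([{1..N}]\<^bsup>k\<^esup>) \<subseteq> down_sets Q"
    "\<And>W. W \<in> [{1..N}]\<^bsup>Suc k\<^esup> \<Longrightarrow> (F (W - {Min W}), F (W - {Max W})) \<notin> snd (J Q)"
    by (auto simp: shift_colouring_def J_def)
  have down: "F (W - {Min W}) \<in> down_sets Q" "F (W - {Max W}) \<in> down_sets Q"
    if "W \<in> [{1..N}]\<^bsup>Suc k\<^esup>" for W
    using F(1) nsets_minus_Min[OF that] nsets_minus_Max[OF that] by blast+
  then have "\<exists>q. q \<in> F (W - {Min W}) \<and> q \<notin> F (W - {Max W})"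
    if "W \<in> [{1..N}]\<^bsup>Suc k\<^esup>" for W
    using F(2)[OF that] that by (auto simp: J_def)
  then obtain f where f: "f W \<in> F (W - {Min W})" "f W \<notin> F (W - {Max W})"
    if "W \<in> [{1..N}]\<^bsup>Suc k\<^esup>" for W
    by metis
  have fin: "f W \<in> fst Q" if "W \<in> [{1..N}]\<^bsup>Suc k\<^esup>" for W
    using f(1)[OF that] down(1)[OF that] by (auto simp: down_sets_def)
  have "(f (X - {Min X}), f (X - {Max X})) \<notin> snd Q" if X: "X \<in> [{1..N}]\<^bsup>Suc (Suc k)\<^esup>" for X
  proof
    assume le: "(f (X - {Min X}), f (X - {Max X})) \<in> snd Q"
    let ?U = "X - {Max X}" and ?V = "X - {Min X}"
    have U: "?U \<in> [{1..N}]\<^bsup>Suc k\<^esup>" and V: "?V \<in> [{1..N}]\<^bsup>Suc k\<^esup>"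
      using nsets_minus_Min[OF X] nsets_minus_Max[OF X] by auto
    \<comment> \<open>Both sides are \<open>X\<close> without its two ends, the vertex at which the
      arcs \<open>?U\<close> and \<open>?V\<close> meet. Its down-set contains \<open>f ?U\<close>
      but not \<open>f ?V\<close>, so \<open>f ?V\<close> cannot lie below
      \<open>f ?U\<close>.\<close>
    have "?U - {Min ?U} = ?V - {Max ?V}"
      using Min_Max_remove_ends(2,3)[of X] nsets_Suc_props[OF X] by auto
    then have "f ?V \<notin> F (?U - {Min ?U})"
      using f(2)[OF V] by simp
    then show False
      using f(1)[OF U] down(1)[OF U] le fin[OF V] by (auto simp: down_sets_def)
  qed
  then have "shift_colouring N (Suc k) Q f"
    using fin by (auto simp: shift_colouring_def)
  then show "\<exists>f. shift_colouring N (Suc k) Q f" by blast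
qed

text \<open>Sorting by the number of elements below gives a linear extension.\<close>

lemma ex_linear_extension:
  assumes Q: "is_poset Q" and fin: "finite (fst Q)"
  obtains xs where "set xs = fst Q" "distinct xs"
    "\<And>i j. i < j \<Longrightarrow> j < length xs \<Longrightarrow> (xs ! j, xs ! i) \<notin> snd Q"
proof -
  define rank where "rank x = card {y \<in> fst Q. (y, x) \<in> snd Q}" for x
  have rank: "rank x < rank y" if "x \<in> fst Q" "y \<in> fst Q" "(x, y) \<in> snd Q" "x \<noteq> y" for x y
  proof -
    have "y \<in> {z \<in> fst Q. (z, y) \<in> snd Q}" "y \<notin> {z \<in> fst Q. (z, x) \<in> snd Q}"
      using that is_posetD[OF Q] by auto
    moreover have "{z \<in> fst Q. (z, x) \<in> snd Q} \<subseteq> {z \<in> fst Q. (z, y) \<in> snd Q}"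
      using that is_posetD(2)[OF Q] by auto
    ultimately show ?thesis
      unfolding rank_def using fin by (intro psubset_card_mono) auto
  qed
  obtain ys where ys: "set ys = fst Q" "distinct ys"
    using fin finite_distinct_list by metis
  define xs where "xs = sort_key rank ys"
  have xs: "set xs = fst Q" "distinct xs" "sorted (map rank xs)"
    using ys by (auto simp: xs_def)
  show thesis
  proof (rule that)
    fix i j assume ij: "i < j" "j < length xs"
    then have "rank (xs ! i) \<le> rank (xs ! j)"
      using sorted_nth_mono[OF xs(3), of i j] by simp
    moreover have "xs ! i \<noteq> xs ! j"
      using ij xs(2) by (simp add: nth_eq_iff_index_eq)
    moreover have "xs ! i \<in> fst Q" "xs ! j \<in> fst Q"
      using ij xs(1) by (metis dual_order.strict_trans nth_mem)+
    ultimately show "(xs ! j, xs ! i) \<notin> snd Q"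
      using rank[of "xs ! j" "xs ! i"] by auto
  qed (use xs in auto)
qed

text \<open>Read along \<open>1, 2, ..., N\<close>, the colours never return to or below an earlier
  one. So they are distinct; conversely, the first \<open>N\<close> entries of a linear extension
  have this property.\<close>

lemma shift_colouring_1_iff:
  assumes Q: "is_poset Q" and fin: "finite (fst Q)"
  shows "(\<exists>f. shift_colouring N 1 Q f) \<longleftrightarrow> N \<le> card (fst Q)"
proof
  assume "\<exists>f. shift_colouring N 1 Q f"
  then obtain f where f: "f ` ([{1..N}]\<^bsup>1\<^esup>) \<subseteq> fst Q"
    "\<And>W. W \<in> [{1..N}]\<^bsup>Suc 1\<^esup> \<Longrightarrow> (f (W - {Min W}), f (W - {Max W})) \<notin> snd Q"
    unfolding shift_colouring_def by blast
  have im: "f {a} \<in> fst Q" if "a \<in> {1..N}" for a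
    using f(1) that by (force simp: nsets_def)
  have neq: "f {a} \<noteq> f {b}" if "a \<in> {1..N}" "b \<in> {1..N}" "a < b" for a b
  proof -
    have "{a, b} \<in> [{1..N}]\<^bsup>Suc 1\<^esup>" "Min {a, b} = a" "Max {a, b} = b"
      using that by (auto simp: nsets_def)
    moreover from this have "{a, b} - {Min {a, b}} = {b}" "{a, b} - {Max {a, b}} = {a}"
      using that by auto
    ultimately have "(f {b}, f {a}) \<notin> snd Q"
      using f(2)[of "{a, b}"] by simp
    then show ?thesis
      using is_posetD(1)[OF Q im[OF that(1)]] by auto
  qed
  then have "inj_on (\<lambda>a. f {a}) {1..N}"
    by (intro linorder_inj_onI') auto
  then have "card {1..N} \<le> card (fst Q)"
    using im fin by (intro card_inj_on_le) auto
  then show "N \<le> card (fst Q)"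
    by simp
next
  assume N: "N \<le> card (fst Q)"
  obtain xs where xs: "set xs = fst Q" "distinct xs"
    "\<And>i j. i < j \<Longrightarrow> j < length xs \<Longrightarrow> (xs ! j, xs ! i) \<notin> snd Q"
    using ex_linear_extension[OF Q fin] by blast
  have len: "length xs = card (fst Q)"
    using xs distinct_card by metis
  \<comment> \<open>\<open>Min V\<close> is the only element of \<open>V\<close>; list positions
    start at 0, the ground set at 1.\<close>
  have "shift_colouring N 1 Q (\<lambda>V. xs ! (Min V - 1))"
    unfolding shift_colouring_def
  proof (intro conjI ballI)
    show "(\<lambda>V. xs ! (Min V - 1)) ` ([{1..N}]\<^bsup>1\<^esup>) \<subseteq> fst Q"
      using N len xs(1) by (force simp: nsets_def card_1_singleton_iff intro!: nth_mem)
  next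
    fix W assume W: "W \<in> [{1..N}]\<^bsup>Suc 1\<^esup>"
    have *: "Min W < Min (W - {Min W})" "Min (W - {Max W}) = Min W"
      using Min_Max_remove_ends(1,2)[of W] nsets_Suc_props[OF W] by auto
    have "Min (W - {Min W}) \<in> {1..N}" "Min W \<in> {1..N}"
      using nsets_minus_Min[OF W] nsets_Suc_props[OF W]
      by (metis Min_in One_nat_def nsets_Suc_props subsetD)+
    then show "(xs ! (Min (W - {Min W}) - 1), xs ! (Min (W - {Max W}) - 1)) \<notin> snd Q"
      unfolding *(2) using * N len by (intro xs(3)) auto
  qed
  then show "\<exists>f. shift_colouring N 1 Q f" by blast
qed

section \<open>Isomorphic posets\<close>

lemma poset_iso_inv_into:
  assumes "poset_iso h P Q"
  shows "poset_iso (inv_into (fst P) h) Q P"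
proof -
  have bij: "bij_betw h (fst P) (fst Q)"
    using assms by (simp add: poset_iso_def)
  have "inv_into (fst P) h x \<in> fst P" "h (inv_into (fst P) h x) = x" if "x \<in> fst Q" for x
    using that bij by (auto simp: bij_betw_def inv_into_into f_inv_into_f)
  then show ?thesis
    using assms bij_betw_inv_into[OF bij] by (simp add: poset_iso_def)
qed

lemma poset_iso_comp:
  assumes "poset_iso h P Q" "poset_iso g Q R"
  shows "poset_iso (g \<circ> h) P R"
proof -
  have "h x \<in> fst Q" if "x \<in> fst P" for x
    using assms(1) that by (auto simp: poset_iso_def bij_betw_def)
  then show ?thesis
    using assms by (auto simp: poset_iso_def intro: bij_betw_trans)
qed

lemma down_sets_subset: "S \<in> down_sets Q \<Longrightarrow> S \<subseteq> fst Q"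
  by (simp add: down_sets_def)

lemma finite_down_sets: "finite (fst Q) \<Longrightarrow> finite (down_sets Q)"
  by (rule finite_subset[of _ "Pow (fst Q)"]) (auto simp: down_sets_def)

lemma image_in_down_sets:
  assumes h: "poset_iso h P Q" and S: "S \<in> down_sets P"
  shows "h ` S \<in> down_sets Q"
proof -
  have bij: "h ` fst P = fst Q" and le: "\<And>x y. x \<in> fst P \<Longrightarrow> y \<in> fst P \<Longrightarrow> (x, y) \<in> snd P \<longleftrightarrow> (h x, h y) \<in> snd Q"
    using h by (auto simp: poset_iso_def bij_betw_def)
  have "x \<in> h ` S" if x: "x \<in> fst Q" and y: "y \<in> h ` S" and xy: "(x, y) \<in> snd Q" for x y
  proof -
    obtain a where a: "a \<in> fst P" "x = h a"
      using x bij by auto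
    obtain b where b: "b \<in> S" "y = h b"
      using y by auto
    have "(a, b) \<in> snd P"
      using xy a b le down_sets_subset[OF S] by blast
    then show ?thesis
      using S a b by (auto simp: down_sets_def)
  qed
  then show ?thesis
    using down_sets_subset[OF S] bij unfolding down_sets_def by blast
qed

text \<open>Lets an isomorphism with a computed poset pass to the next iterate.\<close>

lemma poset_iso_J:
  assumes h: "poset_iso h P Q"
  shows "poset_iso ((`) h) (J P) (J Q)"
proof -
  define g where "g = inv_into (fst P) h"
  have g: "poset_iso g Q P"
    unfolding g_def using h by (rule poset_iso_inv_into)
  have inj: "inj_on h (fst P)" and im: "h ` fst P = fst Q"
    using h by (auto simp: poset_iso_def bij_betw_def)
  have "bij_betw ((`) h) (down_sets P) (down_sets Q)"
  proof (rule bij_betw_byWitness[where f' = "(`) g"])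
    show "\<forall>S \<in> down_sets P. g ` h ` S = S"
      by (simp add: g_def inv_into_image_cancel inj down_sets_subset)
    show "\<forall>S \<in> down_sets Q. h ` g ` S = S"
      by (simp add: g_def image_inv_into_cancel im down_sets_subset)
  qed (use image_in_down_sets[OF h] image_in_down_sets[OF g] in auto)
  moreover have "h ` S \<subseteq> h ` T \<longleftrightarrow> S \<subseteq> T" if "S \<in> down_sets P" "T \<in> down_sets P" for S T
    using inj_on_image_mem_iff[OF inj _ down_sets_subset[OF that(2)]] down_sets_subset[OF that(1)]
    by blast
  ultimately show ?thesis
    by (auto simp: poset_iso_def J_def image_in_down_sets[OF h])
qed

lemma card_poset_iso: "poset_iso h P Q \<Longrightarrow> card (fst P) = card (fst Q)"
  by (auto simp: poset_iso_def dest: bij_betw_same_card)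

lemma shift_colouring_iso:
  assumes h: "poset_iso h P Q" and f: "shift_colouring N k P f"
  shows "shift_colouring N k Q (h \<circ> f)"
  unfolding shift_colouring_def
proof (intro conjI ballI)
  have im: "f V \<in> fst P" if "V \<in> [{1..N}]\<^bsup>k\<^esup>" for V
    using f that by (auto simp: shift_colouring_def)
  then show "(h \<circ> f) ` ([{1..N}]\<^bsup>k\<^esup>) \<subseteq> fst Q"
    using h by (auto simp: poset_iso_def bij_betw_def)
  fix W assume W: "W \<in> [{1..N}]\<^bsup>Suc k\<^esup>"
  then have "(f (W - {Min W}), f (W - {Max W})) \<notin> snd P"
    using f by (auto simp: shift_colouring_def)
  then show "((h \<circ> f) (W - {Min W}), (h \<circ> f) (W - {Max W})) \<notin> snd Q"
    using h im[OF nsets_minus_Min[OF W]] im[OF nsets_minus_Max[OF W]]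
    by (simp add: poset_iso_def)
qed

lemma ex_shift_colouring_iso:
  assumes "poset_iso h P Q"
  shows "(\<exists>f. shift_colouring N k P f) \<longleftrightarrow> (\<exists>f. shift_colouring N k Q f)"
  using shift_colouring_iso[OF assms] shift_colouring_iso[OF poset_iso_inv_into[OF assms]] by blast

section \<open>The three-colour shift number\<close>

lemma is_poset_J_step: "is_poset (J_step Q)"
proof -
  have "antisym (snd (J_step Q))"
    by (rule antisymI) (auto simp: J_step_def J_def fset_inject)
  moreover have "trans (snd (J_step Q))"
    by (rule transI) (auto simp: J_step_def J_def)
  moreover have "refl_on (fst (J_step Q)) (snd (J_step Q))"
    by (rule refl_onI) (auto simp: J_step_def J_def)
  moreover have "snd (J_step Q) \<subseteq> fst (J_step Q) \<times> fst (J_step Q)"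
    by (auto simp: J_step_def J_def)
  ultimately show ?thesis
    by (simp add: is_poset_def partial_order_on_def preorder_on_def)
qed

lemma is_poset_J_iter:
  assumes "is_poset Q"
  shows "is_poset (J_iter i Q)"
proof (cases i)
  case 0
  have "snd Q \<subseteq> fst Q \<times> fst Q"
    using assms by (auto simp: is_poset_def partial_order_on_def preorder_on_def)
  with 0 show ?thesis
    using is_posetD[OF assms]
    by (auto simp: is_poset_def partial_order_on_def preorder_on_def
        intro!: refl_onI transI antisymI)
next
  case (Suc n)
  then show ?thesis
    by (simp add: is_poset_J_step)
qed

text \<open>Each step lowers the size of the vertices by one and applies \<open>J\<close> once to
  the colours. The index \<open>j\<close> is general because the induction moves it.\<close>

lemma ex_shift_colouring_J_iter:
  assumes "is_poset Q" "finite (fst Q)"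
  shows "(\<exists>f. shift_colouring N (Suc i) (J_iter j Q) f) \<longleftrightarrow>
    (\<exists>f. shift_colouring N 1 (J_iter (j + i) Q) f)"
proof (induction i arbitrary: j)
  case 0
  show ?case
    by simp
next
  case (Suc i)
  have "(\<exists>f. shift_colouring N (Suc (Suc i)) (J_iter j Q) f) \<longleftrightarrow>
      (\<exists>f. shift_colouring N (Suc i) (J (J_iter j Q)) f)"
    using is_poset_J_iter[OF assms(1)] by (intro shift_colouring_Suc_iff_J) auto
  also have "\<dots> \<longleftrightarrow> (\<exists>f. shift_colouring N (Suc i) (J_iter (Suc j) Q) f)"
    using J_iso[OF assms(2)] by (rule ex_shift_colouring_iso)
  finally show ?case
    using Suc.IH[of "Suc j"] by simp
qed

lemma card_J_iter_Suc:
  assumes "finite (fst Q)"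
  shows "card (fst (J_iter (Suc i) Q)) = card (down_sets (J_iter i Q))"
  using card_poset_iso[OF J_iso[OF assms, of i]] by (simp add: J_def)

lemma J_iter_nonempty:
  assumes "fst Q \<noteq> {}"
  shows "fst (J_iter i Q) \<noteq> {}"
proof (cases i)
  case 0
  then show ?thesis
    using assms by simp
next
  case (Suc n)
  have "fset {||} \<in> down_sets (J_iter n Q)"
    by (simp add: down_sets_def)
  then have "Down {||} \<in> fst (J_iter i Q)"
    unfolding Suc J_iter.simps J_step_def J_def fst_conv by blast
  then show ?thesis
    by blast
qed

lemma s3_eq_card_J_iter:
  assumes Q: "is_poset Q" "is_antichain Q" "card (fst Q) = 3" and k: "k \<ge> 1"
  shows "s3 k = card (fst (J_iter (k - 1) Q))"
proof -
  have fin: "finite (fst Q)" and ne: "fst Q \<noteq> {}"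
    using Q(3) card.infinite by fastforce+
  let ?n = "card (fst (J_iter (k - 1) Q))"
  have "chromatic_number (shift_graph N k) \<le> 3 \<longleftrightarrow> N \<le> ?n" for N
  proof -
    have "chromatic_number (shift_graph N k) \<le> 3 \<longleftrightarrow> (\<exists>f. shift_colouring N k Q f)"
      using chromatic_number_shift_graph_le_iff[OF k] proper_colouring_iff_shift_colouring[OF Q]
      by simp
    also have "\<dots> \<longleftrightarrow> (\<exists>f. shift_colouring N (Suc (k - 1)) (J_iter 0 Q) f)"
      using ex_shift_colouring_iso[OF J_iter_0_iso] k by simp
    also have "\<dots> \<longleftrightarrow> (\<exists>f. shift_colouring N 1 (J_iter (k - 1) Q) f)"
      using ex_shift_colouring_J_iter[OF Q(1) fin, of N "k - 1" 0] by simp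
    also have "\<dots> \<longleftrightarrow> N \<le> ?n"
      using is_poset_J_iter[OF Q(1)] finite_J_iter[OF fin] by (rule shift_colouring_1_iff)
    finally show ?thesis .
  qed
  then have "{N. N \<ge> 1 \<and> chromatic_number (shift_graph N k) \<le> 3} = {N. N \<ge> 1 \<and> N \<le> ?n}"
    by simp
  also have "\<dots> = {1..?n}"
    by auto
  finally have "{N. N \<ge> 1 \<and> chromatic_number (shift_graph N k) \<le> 3} = {1..?n}" .
  \<comment> \<open>\<open>Max\<close> of the empty set would be unspecified.\<close>
  moreover have "?n \<ge> 1"
    using J_iter_nonempty[OF ne] finite_J_iter[OF fin] by (metis One_nat_def Suc_leI card_gt_0_iff)
  moreover from this have "Max {1..?n} = ?n"
    by (intro Max_eqI) auto
  ultimately show ?thesis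
    unfolding s3_def by simp
qed

section \<open>Antichains\<close>

definition has_antichain :: "nat \<Rightarrow> 'a poset \<Rightarrow> bool" where
  "has_antichain w Q \<longleftrightarrow> (\<exists>A \<subseteq> fst Q. finite A \<and> is_antichain (A, snd Q) \<and> card A = w)"

lemma has_antichain_mono:
  assumes "has_antichain w Q" "v \<le> w"
  shows "has_antichain v Q"
proof -
  obtain A where A: "A \<subseteq> fst Q" "finite A" "is_antichain (A, snd Q)" "card A = w"
    using assms by (auto simp: has_antichain_def)
  obtain B where "B \<subseteq> A" "card B = v" "finite B"
    using obtain_subset_with_card_n[of v A] A assms by auto
  with A show ?thesis
    unfolding has_antichain_def is_antichain_def by (intro exI[of _ B]) auto
qed

lemma has_antichain_iso:
  assumes h: "poset_iso h P Q" and "has_antichain w P"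
  shows "has_antichain w Q"
proof -
  obtain A where A: "A \<subseteq> fst P" "finite A" "is_antichain (A, snd P)" "card A = w"
    using assms by (auto simp: has_antichain_def)
  have inj: "inj_on h A"
    using h A(1) by (auto simp: poset_iso_def bij_betw_def intro: inj_on_subset)
  have "h ` A \<subseteq> fst Q"
    using h A(1) by (auto simp: poset_iso_def bij_betw_def)
  moreover have "is_antichain (h ` A, snd Q)"
    unfolding is_antichain_def
  proof (clarsimp, intro conjI)
    fix x y assume xy: "x \<in> A" "y \<in> A" "h x \<noteq> h y"
    then have "x \<noteq> y" "x \<in> fst P" "y \<in> fst P"
      using A(1) by auto
    then show "(h x, h y) \<notin> snd Q" "(h y, h x) \<notin> snd Q"
      using A(3) h xy unfolding is_antichain_def poset_iso_def by auto
  qed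
  ultimately show ?thesis
    unfolding has_antichain_def using A inj by (intro exI[of _ "h ` A"]) (auto simp: card_image)
qed

text \<open>No element of an antichain lies below another, so closing downwards adds nothing inside
  \<open>A\<close>, and \<open>S\<close> can be read off from \<open>D\<close>.\<close>

lemma down_closure_of_antichain:
  assumes Q: "is_poset Q" and A: "A \<subseteq> fst Q" "is_antichain (A, snd Q)" and S: "S \<subseteq> A"
  defines "D \<equiv> {x \<in> fst Q. \<exists>s \<in> S. (x, s) \<in> snd Q}"
  shows "D \<in> down_sets Q" "D \<inter> A = S"
proof -
  show "D \<in> down_sets Q"
    unfolding D_def down_sets_def using is_posetD(2)[OF Q] by blast
  show "D \<inter> A = S"
    unfolding D_def using S A is_posetD(1)[OF Q] by (fastforce simp: is_antichain_def)
qed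

lemma card_J_ge_antichain:
  assumes Q: "is_poset Q" and fin: "finite (fst Q)" and "has_antichain w Q"
  shows "2 ^ w \<le> card (down_sets Q)"
proof -
  obtain A where A: "A \<subseteq> fst Q" "finite A" "is_antichain (A, snd Q)" "card A = w"
    using assms by (auto simp: has_antichain_def)
  have "Pow A \<subseteq> (\<lambda>D. D \<inter> A) ` down_sets Q"
  proof
    fix S assume "S \<in> Pow A"
    then have "S \<subseteq> A"
      by simp
    note down_closure_of_antichain[OF Q A(1,3) this]
    then show "S \<in> (\<lambda>D. D \<inter> A) ` down_sets Q"
      by (intro image_eqI[OF sym])
  qed
  then have "card (Pow A) \<le> card ((\<lambda>D. D \<inter> A) ` down_sets Q)"
    using finite_down_sets[OF fin] by (intro card_mono) auto
  also have "\<dots> \<le> card (down_sets Q)"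
    using finite_down_sets[OF fin] by (rule card_image_le)
  finally show ?thesis
    using A by (simp add: card_Pow)
qed

text \<open>The down-sets generated by the \<open>m\<close>-element subsets of \<open>A\<close> are
  incomparable: an inclusion between two of them passes to their traces on \<open>A\<close>, which
  have equal size and therefore coincide.\<close>

lemma has_antichain_J:
  assumes Q: "is_poset Q" and "has_antichain w Q"
  shows "has_antichain (w choose m) (J Q)"
proof -
  obtain A where A: "A \<subseteq> fst Q" "finite A" "is_antichain (A, snd Q)" "card A = w"
    using assms by (auto simp: has_antichain_def)
  define D where "D S = {x \<in> fst Q. \<exists>s \<in> S. (x, s) \<in> snd Q}" for S
  define F where "F = {S. S \<subseteq> A \<and> card S = m}"
  have D: "D S \<in> down_sets Q" "D S \<inter> A = S" if "S \<in> F" for S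
    unfolding D_def using down_closure_of_antichain[OF Q A(1,3), of S] that by (auto simp: F_def)
  have eq: "S = T" if "S \<in> F" "T \<in> F" "D S \<subseteq> D T" for S T
  proof -
    have "S \<subseteq> T"
      using D(2)[OF that(1)] D(2)[OF that(2)] that(3) by blast
    then show ?thesis
      using that A(2) by (intro card_subset_eq) (auto simp: F_def intro: finite_subset)
  qed
  then have inj: "inj_on D F"
    by (auto intro!: inj_onI)
  have "finite F"
    using A(2) by (simp add: F_def)
  moreover have "card (D ` F) = w choose m"
    using inj A n_subsets[of A m] by (simp add: card_image F_def)
  moreover have "is_antichain (D ` F, snd (J Q))"
    using eq by (fastforce simp: is_antichain_def J_def)
  ultimately show ?thesis
    unfolding has_antichain_def using D(1) by (intro exI[of _ "D ` F"]) (auto simp: J_def)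
qed

lemma has_antichain_J_iter_Suc:
  assumes "is_poset Q" "finite (fst Q)" "has_antichain w (J_iter i Q)"
  shows "has_antichain (w choose m) (J_iter (Suc i) Q)"
  using J_iso[OF assms(2)] has_antichain_J[OF is_poset_J_iter[OF assms(1)] assms(3)]
  by (rule has_antichain_iso)

text \<open>Turns an antichain of size \<open>2 * n\<close> into one of size
  \<open>2 * 2 ^ n\<close> one level higher. The inequality fails for \<open>n = 2\<close>; from 3
  on each step at least doubles the binomial.\<close>

lemma two_power_Suc_le_central_binomial:
  assumes "n \<ge> 3"
  shows "2 ^ Suc n \<le> (2 * n) choose n"
  using assms
proof (induction n rule: dec_induct)
  case base
  show ?case
    by (simp add: numeral_eq_Suc)
next
  case (step n)
  have "2 * (2 * n choose n) \<le> 2 * (2 * Suc n - 1 choose n)"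
    by (intro mult_left_mono binomial_right_mono) auto
  also have "\<dots> = (2 * Suc n choose Suc n)"
    using binomial_symmetric[of n "Suc (2 * n)"] by simp
  finally show ?case
    using step by simp
qed

section \<open>Iterated down-sets as lists of bits\<close>

fun bits_le :: "bool list \<Rightarrow> bool list \<Rightarrow> bool" where
  "bits_le [] [] = True"
| "bits_le (a # s) (b # t) = (if a then (if b then bits_le s t else False) else bits_le s t)"
| "bits_le _ _ = False"

abbreviation bits_rel :: "bool list rel" where
  "bits_rel \<equiv> {(s, t). bits_le s t}"

definition top_first :: "bool list list \<Rightarrow> bool" where
  "top_first L \<longleftrightarrow> sorted_wrt (\<lambda>s t. \<not> bits_le s t) L"

text \<open>
  A down-set of the poset listed by \<open>L\<close> is a list of bits, one for each entry of \<open>L\<close>; so the posets of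
  all levels have the same type of elements, ordered by \<open>bits_le\<close>. The order \<open>top_first\<close> of \<open>L\<close> makes
  the head a maximal element, which decides last whether it can be added. The auxiliary function
  \<open>prepend_bit\<close> prevents the simplifier from evaluating \<open>down_lists xs\<close> twice.
\<close>

definition prepend_bit :: "bool list \<Rightarrow> bool list list \<Rightarrow> bool list list" where
  "prepend_bit b R = map (Cons True) (filter (bits_le b) R) @ map (Cons False) R"

fun down_lists :: "bool list list \<Rightarrow> bool list list" where
  "down_lists [] = [[]]"
| "down_lists (x # xs) = prepend_bit (map (\<lambda>y. bits_le y x) xs) (down_lists xs)"

fun selected :: "'a list \<Rightarrow> bool list \<Rightarrow> 'a set" where
  "selected (x # xs) (b # bs) = (if b then insert x (selected xs bs) else selected xs bs)"
| "selected _ _ = {}"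

lemma bits_le_refl: "bits_le s s"
  by (induction s) auto

lemma bits_le_trans: "bits_le s t \<Longrightarrow> bits_le t u \<Longrightarrow> bits_le s u"
  by (induction s t arbitrary: u rule: bits_le.induct; case_tac u) (auto split: if_splits)

lemma trans_bits_rel: "trans bits_rel"
  by (auto intro!: transI intro: bits_le_trans)

lemma top_first_distinct: "top_first L \<Longrightarrow> distinct L"
  by (induction L) (auto simp: top_first_def bits_le_refl)

text \<open>Lists starting with \<open>True\<close> come first and are never below lists starting
  with \<open>False\<close>, and a common first bit does not affect the order. Thus the output can
  be fed to \<open>down_lists\<close> again.\<close>

lemma top_first_down_lists: "top_first (down_lists L)"
  by (induction L)
    (auto simp: top_first_def prepend_bit_def sorted_wrt_append sorted_wrt_map sorted_wrt_filter)

lemma length_down_lists: "s \<in> set (down_lists L) \<Longrightarrow> length s = length L"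
  by (induction L arbitrary: s) (auto simp: prepend_bit_def)

lemma selected_subset: "selected xs s \<subseteq> set xs"
  by (induction xs s rule: selected.induct) auto

lemma selected_map: "selected xs (map P xs) = {x \<in> set xs. P x}"
  by (induction xs) auto

lemma selected_subset_iff:
  assumes "distinct xs" "length s = length xs" "length t = length xs"
  shows "selected xs s \<subseteq> selected xs t \<longleftrightarrow> bits_le s t"
  using assms(2,1,3)
proof (induction s xs arbitrary: t rule: list_induct2)
  case Nil
  then show ?case
    by simp
next
  case (Cons a s x xs)
  obtain b u where t: "t = b # u"
    using Cons.prems by (cases t) auto
  have "x \<notin> selected xs s" "x \<notin> selected xs u"
    using Cons.prems selected_subset[of xs] by auto
  then show ?case
    using Cons by (auto simp: t)
qed

text \<open>As \<open>x\<close> is maximal, removing it from a down-set leaves a down-set, and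
  adding it only asks for what lies below. This is the recursion that \<open>down_lists\<close>
  carries out.\<close>

lemma down_sets_insert_top:
  assumes "\<forall>y \<in> A. (x, y) \<notin> r" "(x, x) \<in> r"
  shows "down_sets (insert x A, r) =
    insert x ` {S \<in> down_sets (A, r). {y \<in> A. (y, x) \<in> r} \<subseteq> S} \<union> down_sets (A, r)"
    (is "?L = ?R")
proof
  show "?R \<subseteq> ?L"
    using assms by (auto simp: down_sets_def)
next
  show "?L \<subseteq> ?R"
  proof
    fix S assume S: "S \<in> ?L"
    show "S \<in> ?R"
    proof (cases "x \<in> S")
      case True
      then have "S - {x} \<in> down_sets (A, r)" "{y \<in> A. (y, x) \<in> r} \<subseteq> S - {x}"
        using S assms by (auto simp: down_sets_def)
      moreover have "S = insert x (S - {x})"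
        using True by blast
      ultimately show ?thesis
        by blast
    next
      case False
      then have "S \<in> down_sets (A, r)"
        using S by (auto simp: down_sets_def)
      then show ?thesis
        by blast
    qed
  qed
qed

lemma selected_image_down_lists:
  assumes "top_first L"
  shows "selected L ` set (down_lists L) = down_sets (set L, bits_rel)"
  using assms
proof (induction L)
  case Nil
  show ?case
    by (auto simp: down_sets_def)
next
  case (Cons x xs)
  then have top: "\<forall>y \<in> set xs. \<not> bits_le x y" and xs: "top_first xs"
    by (auto simp: top_first_def)
  let ?b = "map (\<lambda>y. bits_le y x) xs"
  have le: "bits_le ?b s \<longleftrightarrow> {y \<in> set xs. bits_le y x} \<subseteq> selected xs s"
    if "s \<in> set (down_lists xs)" for s
    using selected_subset_iff[OF top_first_distinct[OF xs], of ?b s] length_down_lists[OF that]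
    by (simp add: selected_map)
  have "selected (x # xs) ` set (down_lists (x # xs)) =
      insert x ` selected xs ` {s \<in> set (down_lists xs). bits_le ?b s} \<union>
      selected xs ` set (down_lists xs)"
    by (simp add: prepend_bit_def image_Un image_image)
  also have "selected xs ` {s \<in> set (down_lists xs). bits_le ?b s} =
      {S \<in> selected xs ` set (down_lists xs). {y \<in> set xs. bits_le y x} \<subseteq> S}"
    using le by blast
  also have "insert x ` \<dots> \<union> selected xs ` set (down_lists xs) = down_sets (set (x # xs), bits_rel)"
    using down_sets_insert_top[of "set xs" x bits_rel] top bits_le_refl
    by (simp add: Cons.IH[OF xs])
  finally show ?case .
qed

lemma poset_iso_selected:
  assumes "top_first L"
  shows "poset_iso (selected L) (set (down_lists L), bits_rel) (J (set L, bits_rel))"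
proof -
  have le: "selected L s \<subseteq> selected L t \<longleftrightarrow> bits_le s t"
    if "s \<in> set (down_lists L)" "t \<in> set (down_lists L)" for s t
    using selected_subset_iff[OF top_first_distinct[OF assms]] length_down_lists that by blast
  have antisym: "s = t" if "bits_le s t" "bits_le t s" for s t
    using that by (induction s t rule: bits_le.induct) (auto split: if_splits)
  have "inj_on (selected L) (set (down_lists L))"
    using le antisym by (metis (no_types, lifting) inj_onI order_refl)
  then have "bij_betw (selected L) (set (down_lists L)) (down_sets (set L, bits_rel))"
    by (simp add: bij_betw_def selected_image_down_lists[OF assms])
  moreover have "selected L s \<in> down_sets (set L, bits_rel)" if "s \<in> set (down_lists L)" for s
    using that selected_image_down_lists[OF assms] by blast
  ultimately show ?thesis
    using le by (auto simp: poset_iso_def J_def)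
qed

section \<open>Counting down-sets\<close>

text \<open>A down-set that misses \<open>x\<close> avoids everything above \<open>x\<close>; one
  that contains \<open>x\<close> contains everything below, and dropping that part loses no
  information.\<close>

lemma card_down_sets_split:
  assumes fin: "finite A" and r: "trans r" and x: "x \<in> A" "(x, x) \<in> r"
  shows "card (down_sets (A, r)) =
    card (down_sets ({y \<in> A. (x, y) \<notin> r}, r)) + card (down_sets ({y \<in> A. (y, x) \<notin> r}, r))"
proof -
  let ?U = "{y \<in> A. (x, y) \<notin> r}" and ?D = "{y \<in> A. (y, x) \<notin> r}" and ?B = "{y \<in> A. (y, x) \<in> r}"
  have U: "{S \<in> down_sets (A, r). x \<notin> S} = down_sets (?U, r)"
    using x r by (auto simp: down_sets_def dest: transD)
  have "bij_betw (\<lambda>S. S - ?B) {S \<in> down_sets (A, r). x \<in> S} (down_sets (?D, r))"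
  proof (rule bij_betw_byWitness[where f' = "\<lambda>T. T \<union> ?B"])
    show "\<forall>S \<in> {S \<in> down_sets (A, r). x \<in> S}. S - ?B \<union> ?B = S"
      by (auto simp: down_sets_def)
    show "\<forall>T \<in> down_sets (?D, r). T \<union> ?B - ?B = T"
      by (auto simp: down_sets_def)
    show "(\<lambda>S. S - ?B) ` {S \<in> down_sets (A, r). x \<in> S} \<subseteq> down_sets (?D, r)"
      by (auto simp: down_sets_def)
    show "(\<lambda>T. T \<union> ?B) ` down_sets (?D, r) \<subseteq> {S \<in> down_sets (A, r). x \<in> S}"
      using x r by (auto simp: down_sets_def dest: transD)
  qed
  then have D: "card {S \<in> down_sets (A, r). x \<in> S} = card (down_sets (?D, r))"
    by (rule bij_betw_same_card)
  have "finite (down_sets (A, r))"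
    using fin by (simp add: finite_down_sets)
  then have "card ({S \<in> down_sets (A, r). x \<notin> S} \<union> {S \<in> down_sets (A, r). x \<in> S}) =
      card {S \<in> down_sets (A, r). x \<notin> S} + card {S \<in> down_sets (A, r). x \<in> S}"
    by (intro card_Un_disjoint) auto
  also have "{S \<in> down_sets (A, r). x \<notin> S} \<union> {S \<in> down_sets (A, r). x \<in> S} = down_sets (A, r)"
    by blast
  finally show ?thesis
    unfolding U D .
qed

text \<open>A down-set of the union is determined by its traces on \<open>A\<close> and
  \<open>B\<close>, which are down-sets themselves.\<close>

lemma card_down_sets_Un_le:
  assumes "finite A" "finite B"
  shows "card (down_sets (A \<union> B, r)) \<le> card (down_sets (A, r)) * card (down_sets (B, r))"
proof -
  have "inj_on (\<lambda>S. (S \<inter> A, S \<inter> B)) (down_sets (A \<union> B, r))"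
    by (rule inj_onI) (auto simp: down_sets_def)
  moreover have "(\<lambda>S. (S \<inter> A, S \<inter> B)) ` down_sets (A \<union> B, r) \<subseteq> down_sets (A, r) \<times> down_sets (B, r)"
    by (auto simp: down_sets_def)
  moreover have "finite (down_sets (A, r) \<times> down_sets (B, r))"
    using assms by (simp add: finite_down_sets)
  ultimately have "card (down_sets (A \<union> B, r)) \<le> card (down_sets (A, r) \<times> down_sets (B, r))"
    by (rule card_inj_on_le)
  then show ?thesis
    by (simp add: card_cartesian_product)
qed

text \<open>The list descends, so its head is the top and only the whole chain is a down-set
  containing it.\<close>

lemma card_down_sets_chain_le:
  assumes "sorted_wrt (\<lambda>x y. (y, x) \<in> r) c"
  shows "card (down_sets (set c, r)) \<le> Suc (length c)"
  using assms
proof (induction c)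
  case Nil
  have "down_sets (set [], r) = {{}}"
    by (auto simp: down_sets_def)
  then show ?case
    by simp
next
  case (Cons x c)
  have "down_sets (set (x # c), r) \<subseteq> insert (insert x (set c)) (down_sets (set c, r))"
    using Cons.prems by (auto simp: down_sets_def)
  then have "card (down_sets (set (x # c), r)) \<le> card (insert (insert x (set c)) (down_sets (set c, r)))"
    by (intro card_mono finite.insertI finite_down_sets) simp_all
  also have "\<dots> \<le> Suc (card (down_sets (set c, r)))"
    by (rule card_insert_le_m1[THEN order_trans]) auto
  finally show ?case
    using Cons by simp
qed

text \<open>Every final segment of \<open>L\<close>, the empty one included, is a down-set, since no
  entry lies below a later one.\<close>

lemma card_down_sets_ge_length:
  assumes "top_first L"
  shows "length L < card (down_sets (set L, bits_rel))"
  using assms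
proof (induction L)
  case Nil
  have "down_sets (set [], bits_rel) = {{}}"
    by (auto simp: down_sets_def)
  then show ?case
    by simp
next
  case (Cons x L)
  have "set (x # L) \<notin> down_sets (set L, bits_rel)"
    using top_first_distinct[OF Cons.prems] by (auto simp: down_sets_def)
  then have "Suc (card (down_sets (set L, bits_rel))) =
      card (insert (set (x # L)) (down_sets (set L, bits_rel)))"
    by (intro card_insert_disjoint[symmetric] finite_down_sets) simp_all
  also have "\<dots> \<le> card (down_sets (set (x # L), bits_rel))"
  proof (intro card_mono finite_down_sets)
    have "\<forall>y \<in> set L. (x, y) \<notin> bits_rel" "(x, x) \<in> bits_rel"
      using Cons.prems by (auto simp: top_first_def bits_le_refl)
    from down_sets_insert_top[OF this]
    have "down_sets (set L, bits_rel) \<subseteq> down_sets (set (x # L), bits_rel)"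
      by simp
    moreover have "set (x # L) \<in> down_sets (set (x # L), bits_rel)"
      by (simp add: down_sets_def)
    ultimately show "insert (set (x # L)) (down_sets (set L, bits_rel)) \<subseteq> down_sets (set (x # L), bits_rel)"
      by blast
  qed simp
  finally show ?case
    using Cons by (simp add: top_first_def)
qed

section \<open>Upper bounds from chain covers\<close>

fun insert_chain :: "bool list \<Rightarrow> bool list list list \<Rightarrow> bool list list list" where
  "insert_chain x [] = [[x]]"
| "insert_chain x (c # cs) =
    (if bits_le (hd c) x then (x # c) # cs else c # insert_chain x cs)"

text \<open>The cover is greedy and not necessarily smallest: on a \<open>top_first\<close> list
  \<open>foldr\<close> meets smaller elements before larger ones, and each goes on top of the first
  chain that admits it.\<close>

definition chain_bound :: "bool list list \<Rightarrow> int" where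
  "chain_bound L = prod_list (map (\<lambda>c. int (Suc (length c))) (foldr insert_chain L []))"

definition is_chain_list :: "bool list list \<Rightarrow> bool" where
  "is_chain_list c \<longleftrightarrow> c \<noteq> [] \<and> sorted_wrt (\<lambda>x y. (y, x) \<in> bits_rel) c"

lemma insert_chain_invariant:
  assumes "\<forall>c \<in> set cs. is_chain_list c"
  shows "(\<forall>c \<in> set (insert_chain x cs). is_chain_list c) \<and>
    \<Union> (set ` set (insert_chain x cs)) = insert x (\<Union> (set ` set cs))"
  using assms
proof (induction x cs rule: insert_chain.induct)
  case (1 x)
  show ?case
    by (simp add: is_chain_list_def)
next
  case (2 x c cs)
  have "is_chain_list (x # c)" if "bits_le (hd c) x"
    using 2(2) that by (cases c) (auto simp: is_chain_list_def intro: bits_le_trans)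
  then show ?case
    using 2 by auto
qed

lemma foldr_insert_chain_invariant:
  "(\<forall>c \<in> set (foldr insert_chain L []). is_chain_list c) \<and>
    \<Union> (set ` set (foldr insert_chain L [])) = set L"
  by (induction L) (auto simp: insert_chain_invariant)

lemma card_down_sets_le_chain_bound:
  "int (card (down_sets (set L, bits_rel))) \<le> chain_bound L"
proof -
  have "int (card (down_sets (\<Union> (set ` set cs), bits_rel))) \<le>
      prod_list (map (\<lambda>c. int (Suc (length c))) cs)"
    if "\<forall>c \<in> set cs. is_chain_list c" for cs
    using that
  proof (induction cs)
    case Nil
    have "down_sets ({}, bits_rel) = {{}}"
      by (auto simp: down_sets_def)
    then show ?case
      by simp
  next
    case (Cons c cs)
    have "int (card (down_sets (set c \<union> \<Union> (set ` set cs), bits_rel))) \<le>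
        int (card (down_sets (set c, bits_rel))) * int (card (down_sets (\<Union> (set ` set cs), bits_rel)))"
      unfolding of_nat_mult[symmetric] of_nat_le_iff by (rule card_down_sets_Un_le) auto
    also have "\<dots> \<le> int (Suc (length c)) * prod_list (map (\<lambda>c. int (Suc (length c))) cs)"
      using Cons card_down_sets_chain_le[of bits_rel c]
      by (intro mult_mono) (auto simp: is_chain_list_def)
    finally show ?case
      by simp
  qed
  from this[of "foldr insert_chain L []"] show ?thesis
    using foldr_insert_chain_invariant[of L] unfolding chain_bound_def by metis
qed

text \<open>The second list is traversed at double speed, so that the first one stops in the middle.\<close>

fun middle :: "'a list \<Rightarrow> 'b list \<Rightarrow> 'a" where
  "middle (x # xs) (_ # _ # ys) = middle xs ys"
| "middle (x # xs) _ = x"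

definition split_at :: "bool list \<Rightarrow> bool list list \<Rightarrow> bool list list list" where
  "split_at x L = [filter (\<lambda>y. \<not> bits_le x y) L, filter (\<lambda>y. \<not> bits_le y x) L]"

text \<open>The empty list is kept because the empty poset has one down-set, so the sum of the
  counts is preserved. A pivot from the middle is meant to have many elements both above and below,
  which shrinks both parts.\<close>

fun split_middle :: "bool list list \<Rightarrow> bool list list list" where
  "split_middle [] = [[]]"
| "split_middle (x # L) = split_at (middle (x # L) L) (x # L)"

primrec split_iter :: "nat \<Rightarrow> bool list list list \<Rightarrow> bool list list list" where
  "split_iter 0 Ls = Ls"
| "split_iter (Suc n) Ls = split_iter n (concat (map split_middle Ls))"

abbreviation num_down_sets :: "bool list list \<Rightarrow> int" where
  "num_down_sets L \<equiv> int (card (down_sets (set L, bits_rel)))"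

lemma middle_in_set: "length ys < length xs \<Longrightarrow> middle xs ys \<in> set xs"
  by (induction xs ys rule: middle.induct) auto

lemma num_down_sets_split_middle:
  "sum_list (map num_down_sets (split_middle L)) = num_down_sets L"
proof (cases "L = []")
  case False
  then obtain y where y: "y \<in> set L" "split_middle L = split_at y L"
    using middle_in_set[of "tl L" L] by (cases L) auto
  from card_down_sets_split[OF finite_set trans_bits_rel y(1)] show ?thesis
    by (simp add: y(2) split_at_def bits_le_refl)
qed simp

lemma num_down_sets_split_iter:
  "sum_list (map num_down_sets (split_iter n Ls)) = sum_list (map num_down_sets Ls)"
proof (induction n arbitrary: Ls)
  case (Suc n)
  have "sum_list (map num_down_sets (concat (map split_middle Ls))) = sum_list (map num_down_sets Ls)"
    by (induction Ls) (simp_all add: num_down_sets_split_middle)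
  with Suc show ?case
    by simp
qed simp

lemma top_first_split_iter:
  assumes "\<forall>L \<in> set Ls. top_first L"
  shows "\<forall>L \<in> set (split_iter n Ls). top_first L"
  using assms
proof (induction n arbitrary: Ls)
  case (Suc n)
  have "top_first L'" if "top_first L" "L' \<in> set (split_middle L)" for L L'
  proof (cases "L = []")
    case False
    then obtain y where "split_middle L = split_at y L"
      by (cases L) auto
    then show ?thesis
      using that by (auto simp: split_at_def top_first_def intro: sorted_wrt_filter)
  qed (use that in simp)
  then have "\<forall>L \<in> set (concat (map split_middle Ls)). top_first L"
    using Suc.prems by auto
  then show ?case
    unfolding split_iter.simps by (rule Suc.IH)
qed simp

lemma num_down_sets_le:
  "num_down_sets L \<le> sum_list (map chain_bound (split_iter n [L]))"
proof -
  have "num_down_sets L = sum_list (map num_down_sets (split_iter n [L]))"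
    by (simp add: num_down_sets_split_iter)
  also have "\<dots> \<le> sum_list (map chain_bound (split_iter n [L]))"
    by (intro sum_list_mono card_down_sets_le_chain_bound)
  finally show ?thesis .
qed

lemma num_down_sets_ge:
  assumes "top_first L"
  shows "sum_list (map (\<lambda>L. int (Suc (length L))) (split_iter n [L])) \<le> num_down_sets L"
proof -
  have "top_first L'" if "L' \<in> set (split_iter n [L])" for L'
    using top_first_split_iter[of "[L]"] assms that by simp
  then have "sum_list (map (\<lambda>L. int (Suc (length L))) (split_iter n [L])) \<le>
      sum_list (map num_down_sets (split_iter n [L]))"
    by (intro sum_list_mono) (simp add: Suc_le_eq card_down_sets_ge_length del: of_nat_Suc)
  also have "\<dots> = num_down_sets L"
    by (simp add: num_down_sets_split_iter)
  finally show ?thesis .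
qed

section \<open>Computation for the third iterate\<close>

definition unit_lists :: "bool list list" where
  "unit_lists = [[True, False, False], [False, True, False], [False, False, True]]"

text \<open>
  The list \<open>(down_lists ^^ 3) unit_lists\<close> represents \<open>J\<^sup>3(A\<^sub>3)\<close>, which has 84 elements. The exact number
  of its down-sets is 8573; the bounds below need far fewer steps than a full enumeration.
\<close>

lemma length_level_8:
  "length (filter (\<lambda>s. length (filter (\<lambda>b. b) s) = 8) ((down_lists ^^ 3) unit_lists)) = 7"
  by code_simp

lemma sum_length_split_iter_ge:
  "256 \<le> sum_list (map (\<lambda>L. int (Suc (length L))) (split_iter 5 [(down_lists ^^ 3) unit_lists]))"
  by code_simp

lemma sum_chain_bound_split_iter_le:
  "sum_list (map chain_bound (split_iter 9 [(down_lists ^^ 3) unit_lists])) \<le> 32768"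
  by code_simp

lemma top_first_unit_lists: "top_first unit_lists"
  by (simp add: top_first_def unit_lists_def)

lemma top_first_down_lists_iter: "top_first ((down_lists ^^ i) unit_lists)"
  by (cases i) (simp_all add: top_first_unit_lists top_first_down_lists)

lemma ex_poset_iso_down_lists_iter:
  assumes Q: "is_poset Q" "is_antichain Q" "card (fst Q) = 3"
  shows "\<exists>h. poset_iso h (set ((down_lists ^^ i) unit_lists), bits_rel) (J_iter i Q)"
proof (induction i)
  case 0
  have "finite (fst Q)"
    using Q(3) by (intro card_ge_0_finite) simp
  moreover have "card (set unit_lists) = card (fst Q)"
    using Q(3) by (simp add: unit_lists_def)
  ultimately obtain h where h: "bij_betw h (set unit_lists) (fst Q)"
    using finite_same_card_bij[of "set unit_lists" "fst Q"] by auto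
  have le: "bits_le s t \<longleftrightarrow> s = t" if "s \<in> set unit_lists" "t \<in> set unit_lists" for s t
    using that by (auto simp: unit_lists_def)
  have "poset_iso h (set unit_lists, bits_rel) Q"
    unfolding poset_iso_def
  proof (intro conjI ballI)
    fix s t assume st: "s \<in> fst (set unit_lists, bits_rel)" "t \<in> fst (set unit_lists, bits_rel)"
    then have "h s \<in> fst Q" "h t \<in> fst Q" "h s = h t \<longleftrightarrow> s = t"
      using h by (auto simp: bij_betw_def inj_on_eq_iff)
    then show "(s, t) \<in> snd (set unit_lists, bits_rel) \<longleftrightarrow> (h s, h t) \<in> snd Q"
      using le st antichain_poset_le_iff[OF Q(1,2)] by simp
  qed (use h in simp)
  from poset_iso_comp[OF this J_iter_0_iso] show ?case
    by auto
next
  case (Suc i)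
  then obtain h where h: "poset_iso h (set ((down_lists ^^ i) unit_lists), bits_rel) (J_iter i Q)" ..
  have "finite (fst Q)"
    using Q(3) by (intro card_ge_0_finite) simp
  \<comment> \<open>From bit lists to down-sets of the listed poset, by \<open>h\<close> to those of
    \<open>J_iter i Q\<close>, and on to \<open>J_iter (Suc i) Q\<close>.\<close>
  from poset_iso_comp[OF poset_iso_comp[OF poset_iso_selected[OF top_first_down_lists_iter]
        poset_iso_J[OF h]] J_iso[OF this]]
  show ?case
    by auto
qed

lemma bits_le_count:
  assumes "bits_le s t" "length (filter (\<lambda>b. b) s) = length (filter (\<lambda>b. b) t)"
  shows "s = t"
proof -
  have "length (filter (\<lambda>b. b) s) \<le> length (filter (\<lambda>b. b) t)" if "bits_le s t" for s t
    using that by (induction s t rule: bits_le.induct) (auto split: if_splits)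
  with assms show ?thesis
    by (induction s t rule: bits_le.induct) (fastforce split: if_splits)+
qed

section \<open>Tower bounds for the iterates\<close>

lemma twr_Suc: "n \<ge> 1 \<Longrightarrow> twr (Suc n) x = 2 ^ twr n x"
  by (cases n) auto

lemma twr_3_2: "twr 3 2 = 16" and twr_4_2: "twr 4 2 = 65536"
proof -
  have "twr (Suc (Suc 0)) 2 = 4"
    by simp
  then have "twr 2 2 = 4"
    by (simp only: One_nat_def[symmetric] Suc_1)
  then show "twr 3 2 = 16"
    using twr_Suc[of 2 2] by simp
  then show "twr 4 2 = 65536"
    using twr_Suc[of 3 2] by simp
qed

context
  fixes Q :: "'a poset"
  assumes Q: "is_poset Q" "is_antichain Q" "card (fst Q) = 3"
begin

lemma finite_Q: "finite (fst Q)"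
  using Q(3) by (intro card_ge_0_finite) simp

lemma has_antichain_J_iter_3: "has_antichain 7 (J_iter 3 Q)"
proof -
  let ?L = "(down_lists ^^ 3) unit_lists"
  \<comment> \<open>These code the down-sets with exactly 8 elements; there are 7 of them, and their
    equal size makes them incomparable.\<close>
  let ?F = "filter (\<lambda>s. length (filter (\<lambda>b. b) s) = 8) ?L"
  have "card (set ?F) = 7"
    using length_level_8 distinct_card[of ?F]
      distinct_filter[OF top_first_distinct[OF top_first_down_lists_iter]] by metis
  moreover have "is_antichain (set ?F, bits_rel)"
    using bits_le_count by (force simp: is_antichain_def)
  ultimately have "has_antichain 7 (set ?L, bits_rel)"
    unfolding has_antichain_def by (intro exI[of _ "set ?F"]) auto
  moreover from ex_poset_iso_down_lists_iter[OF Q]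
  obtain h where "poset_iso h (set ?L, bits_rel) (J_iter 3 Q)" ..
  ultimately show ?thesis
    by (metis has_antichain_iso)
qed

text \<open>The case \<open>k = 5\<close> of both bounds: 256 is the square of
  \<open>twr 3 2\<close> and 32768 is half of \<open>twr 4 2\<close>.\<close>

lemma card_J_iter_4: "card (fst (J_iter 4 Q)) \<in> {256..32768}"
proof -
  let ?L = "(down_lists ^^ 3) unit_lists"
  from ex_poset_iso_down_lists_iter[OF Q]
  obtain h where "poset_iso h (set ?L, bits_rel) (J_iter 3 Q)" ..
  from card_poset_iso[OF poset_iso_J[OF this]]
  have "card (fst (J_iter 4 Q)) = card (down_sets (set ?L, bits_rel))"
    using card_J_iter_Suc[OF finite_Q, of 3] by (simp add: J_def)
  moreover have "num_down_sets ?L \<le> 32768"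
    using num_down_sets_le sum_chain_bound_split_iter_le by (rule order_trans)
  moreover have "256 \<le> num_down_sets ?L"
    using sum_length_split_iter_ge num_down_sets_ge[OF top_first_down_lists_iter] by (rule order_trans)
  ultimately show ?thesis
    by simp
qed

text \<open>The factor 2 keeps the induction going: an antichain of size \<open>2 * t\<close> yields
  one of size \<open>2 * t choose t\<close>, which is at least \<open>2 * 2 ^ t\<close>. The start
  is \<open>7 choose 3\<close>, that is 35, which exceeds 32.\<close>

lemma has_antichain_twr: "has_antichain (2 * twr (i + 3) 2) (J_iter (i + 4) Q)"
proof (induction i)
  case 0
  have "has_antichain (7 choose 3) (J_iter 4 Q)"
    using has_antichain_J_iter_Suc[OF Q(1) finite_Q has_antichain_J_iter_3] by (simp del: J_iter.simps)
  moreover have "(7 :: nat) choose 3 = 35"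
    by (simp add: numeral_eq_Suc)
  ultimately show ?case
    using has_antichain_mono[of 35 _ 32] by (simp add: twr_3_2)
next
  case (Suc i)
  let ?t = "twr (i + 3) 2"
  have t: "twr (Suc i + 3) 2 = 2 ^ ?t"
    unfolding add_Suc by (rule twr_Suc) simp
  have "twr 3 2 \<le> ?t"
  proof (induction i)
    case (Suc i)
    have "twr (Suc i + 3) 2 = 2 ^ twr (i + 3) 2"
      unfolding add_Suc by (rule twr_Suc) simp
    with Suc show ?case
      using less_exp[of "twr (i + 3) 2"] by linarith
  qed simp
  then have "?t \<ge> 3"
    by (simp add: twr_3_2)
  then have "2 * twr (Suc i + 3) 2 \<le> 2 * ?t choose ?t"
    using two_power_Suc_le_central_binomial[of ?t] t by simp
  moreover have "has_antichain (2 * ?t choose ?t) (J_iter (Suc (i + 4)) Q)"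
    using Q(1) finite_Q Suc by (rule has_antichain_J_iter_Suc)
  ultimately show ?case
    by (simp add: has_antichain_mono del: J_iter.simps)
qed

lemma card_J_iter_ge: "(twr (i + 3) 2)\<^sup>2 \<le> card (fst (J_iter (i + 4) Q))"
proof (cases i)
  \<comment> \<open>The antichain of 7 elements in \<open>J_iter 3 Q\<close> would guarantee only
    128 down-sets, so the computed bound is used.\<close>
  case 0
  then show ?thesis
    using card_J_iter_4 by (simp add: twr_3_2)
next
  case (Suc j)
  have "twr (i + 3) 2 = 2 ^ twr (j + 3) 2"
    unfolding Suc add_Suc by (rule twr_Suc) simp
  \<comment> \<open>The factor 2 in the size of the antichain becomes the square.\<close>
  then have "(twr (i + 3) 2)\<^sup>2 = 2 ^ (2 * twr (j + 3) 2)"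
    by (simp add: power_mult[symmetric] mult.commute)
  also have "\<dots> \<le> card (down_sets (J_iter (j + 4) Q))"
    using is_poset_J_iter[OF Q(1)] finite_J_iter[OF finite_Q] has_antichain_twr
    by (rule card_J_ge_antichain)
  also have "\<dots> = card (fst (J_iter (i + 4) Q))"
    using card_J_iter_Suc[OF finite_Q, of "j + 4"] by (simp add: Suc del: J_iter.simps)
  finally show ?thesis .
qed

text \<open>The factor 2 on the left survives the induction: a poset of \<open>n\<close> elements
  has at most \<open>2 ^ n\<close> down-sets, twice that is \<open>2 ^ Suc n\<close>, and
  \<open>Suc n\<close> is at most \<open>2 * n\<close> for positive \<open>n\<close>.\<close>

lemma card_J_iter_le: "2 * card (fst (J_iter (i + 4) Q)) \<le> twr (i + 4) 2"
proof (induction i)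
  case 0
  then show ?case
    using card_J_iter_4 by (simp add: twr_4_2)
next
  case (Suc i)
  let ?P = "J_iter (i + 4) Q"
  have pos: "card (fst ?P) > 0"
    using J_iter_nonempty[of Q "i + 4"] Q(3) finite_J_iter[OF finite_Q, of "i + 4"]
    by (metis card.empty card_gt_0_iff zero_neq_numeral)
  have "2 * card (fst (J_iter (Suc i + 4) Q)) = 2 * card (down_sets ?P)"
    using card_J_iter_Suc[OF finite_Q, of "i + 4"] by (simp del: J_iter.simps)
  also have "\<dots> \<le> 2 * card (Pow (fst ?P))"
    using finite_J_iter[OF finite_Q] by (intro mult_left_mono card_mono) (auto simp: down_sets_def)
  also have "\<dots> = 2 ^ Suc (card (fst ?P))"
    using finite_J_iter[OF finite_Q] by (simp add: card_Pow)
  also have "\<dots> \<le> 2 ^ twr (i + 4) 2"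
    using Suc pos by (intro power_increasing) auto
  also have "\<dots> = twr (Suc i + 4) 2"
    unfolding add_Suc by (rule twr_Suc[symmetric]) simp
  finally show ?case .
qed

end

theorem theorem1p3:
  fixes A3 :: "'a poset"
  assumes "is_poset A3" and "is_antichain A3" and "card (fst A3) = 3"
  shows "(\<forall>k \<ge> 1. s3 k = card (fst (J_iter (k - 1) A3))) \<and>
    (\<forall>k \<ge> 5. (twr (k - 2) 2)\<^sup>2 \<le> s3 k \<and>
       s3 k = card (fst (J_iter (k - 1) A3)) \<and>
       real (card (fst (J_iter (k - 1) A3))) \<le> real (twr (k - 1) 2) / 2)"
proof (intro conjI allI impI)
  show s3: "s3 k = card (fst (J_iter (k - 1) A3))" if "k \<ge> 1" for k
    using s3_eq_card_J_iter[OF assms that] .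
  fix k :: nat
  assume "k \<ge> 5"
  then obtain i where i: "k = i + 5"
    using le_Suc_ex add.commute by metis
  then have k: "k - 2 = i + 3" "k - 1 = i + 4"
    by simp_all
  show "s3 k = card (fst (J_iter (k - 1) A3))"
    using s3 i by simp
  then show "(twr (k - 2) 2)\<^sup>2 \<le> s3 k"
    unfolding k using card_J_iter_ge[OF assms] by simp
  have "2 * card (fst (J_iter (k - 1) A3)) \<le> twr (k - 1) 2"
    unfolding k by (rule card_J_iter_le[OF assms])
  then show "real (card (fst (J_iter (k - 1) A3))) \<le> real (twr (k - 1) 2) / 2"
    by linarith
qed

end
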